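(* Let $\mathcal O$ be the orbit of the walk and $k(\mathcal O)\subset\mathbb K$ the field generated over $k=\mathbb C(S(x,y))$ by all coordinates of the pairs of $\mathcal O$. Then the field extensions $k(\mathcal O)\,|\,k(x)$, $k(\mathcal O)\,|\,k(y)$ and $k(\mathcal O)\,|\,k(x,y)$ are Galois.
   Context: Fix a finite set $\mathcal S\subset\mathbb Z^2$ and nonzero complex weights $(w_s)_{s\in\mathcal S}$; the step polynomial is the Laurent polynomial $S(X,Y)=\sum_{(i,j)\in\mathcal S}w_{(i,j)}X^iY^j$, assumed not univariate (it involves both $X$ and $Y$). Let $x,y$ be algebraically independent over $\mathbb C$, let $k=\mathbb C(S(x,y))$, and let $\mathbb K$ be a fixed algebraic closure of $\mathbb C(x,y)$. For $(u,v),(u',v')\in\mathbb K\times\mathbb K$ write $(u,v)\sim^x(u',v')$ if $u=u'$ and $S(u,v)=S(u',v')$, and $(u,v)\sim^y(u',v')$ if $v=v'$ and $S(u,v)=S(u',v')$. The orbit $\mathcal O$ is the equivalence class of $(x,y)$ for the equivalence relation on $\mathbb K\times\mathbb K$ generated by $\sim^x$ and $\sim^y$ (reflexive transitive closure of their union). An algebraic field extension $L\,|\,M$ (possibly of infinite degree) is called Galois if the set of elements of $L$ fixed by every field automorphism of $L$ fixing $M$ pointwise is exactly $M$. *)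

theory Defs
  imports Complex_Main "HOL-Computational_Algebra.Polynomial"
begin

text \<open>
  The ambient field is a type \<open>'k\<close>; its subfields are subsets of \<open>'k\<close>, and an extension
  \<open>L | M\<close> is given by two subfields \<open>M \<subseteq> L\<close>.
\<close>

definition is_subfield :: "'k::field set \<Rightarrow> bool" where
  "is_subfield F \<longleftrightarrow> 0 \<in> F \<and> 1 \<in> F \<and>
     (\<forall>a\<in>F. \<forall>b\<in>F. a + b \<in> F) \<and> (\<forall>a\<in>F. - a \<in> F) \<and>
     (\<forall>a\<in>F. \<forall>b\<in>F. a * b \<in> F) \<and> (\<forall>a\<in>F. inverse a \<in> F)"

definition field_adjoin :: "'k::field set \<Rightarrow> 'k set \<Rightarrow> 'k set" where
  "field_adjoin M A = \<Inter>{F. is_subfield F \<and> M \<subseteq> F \<and> A \<subseteq> F}"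

definition algebraic_over :: "'k::field set \<Rightarrow> 'k \<Rightarrow> bool" where
  "algebraic_over F z \<longleftrightarrow> (\<exists>p. p \<noteq> 0 \<and> (\<forall>i. coeff p i \<in> F) \<and> poly p z = 0)"

text \<open>Only the values of \<open>\<sigma>\<close> on \<open>L\<close> matter here.\<close>

definition field_automorphism_over :: "'k::field set \<Rightarrow> 'k set \<Rightarrow> ('k \<Rightarrow> 'k) \<Rightarrow> bool" where
  "field_automorphism_over M L \<sigma> \<longleftrightarrow> bij_betw \<sigma> L L \<and> \<sigma> 1 = 1 \<and>
     (\<forall>a\<in>L. \<forall>b\<in>L. \<sigma> (a + b) = \<sigma> a + \<sigma> b) \<and>
     (\<forall>a\<in>L. \<forall>b\<in>L. \<sigma> (a * b) = \<sigma> a * \<sigma> b) \<and>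
     (\<forall>a\<in>M. \<sigma> a = a)"

definition galois_extension :: "'k::field set \<Rightarrow> 'k set \<Rightarrow> bool" where
  "galois_extension L M \<longleftrightarrow> is_subfield L \<and> is_subfield M \<and> M \<subseteq> L \<and>
     (\<forall>z\<in>L. algebraic_over M z) \<and>
     {z \<in> L. \<forall>\<sigma>. field_automorphism_over M L \<sigma> \<longrightarrow> \<sigma> z = z} = M"

definition field_embedding :: "('c::field \<Rightarrow> 'k::field) \<Rightarrow> bool" where
  "field_embedding \<iota> \<longleftrightarrow> \<iota> 1 = 1 \<and>
     (\<forall>a b. \<iota> (a + b) = \<iota> a + \<iota> b) \<and> (\<forall>a b. \<iota> (a * b) = \<iota> a * \<iota> b)"

text \<open>
  A polynomial in two variables is an element of \<open>'c poly poly\<close>: the coefficients are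
  polynomials in the first variable.
\<close>

definition algebraically_independent2 :: "('c::field \<Rightarrow> 'k::field) \<Rightarrow> 'k \<Rightarrow> 'k \<Rightarrow> bool" where
  "algebraically_independent2 \<iota> x y \<longleftrightarrow>
     (\<forall>P::'c poly poly. P \<noteq> 0 \<longrightarrow> poly (map_poly (\<lambda>q. poly (map_poly \<iota> q) x) P) y \<noteq> 0)"

text \<open>That \<open>'k\<close> is algebraically closed is expressed by its type class.\<close>

definition is_algebraic_closure_of :: "'k::alg_closed_field itself \<Rightarrow> 'k set \<Rightarrow> bool" where
  "is_algebraic_closure_of _ F \<longleftrightarrow> is_subfield F \<and> (\<forall>z::'k. algebraic_over F z)"

text \<open>
  Value at \<open>(u, v)\<close> of the Laurent polynomial with support \<open>S\<close> and weights \<open>w\<close>. It is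
  meaningful only where no negative power of zero occurs, which is what
  \<open>step_defined\<close> says (in HOL, negative powers of zero are zero).
\<close>

definition step_eval ::
  "('c::field \<Rightarrow> 'k::field) \<Rightarrow> (int \<times> int) set \<Rightarrow> (int \<times> int \<Rightarrow> 'c) \<Rightarrow> 'k \<Rightarrow> 'k \<Rightarrow> 'k" where
  "step_eval \<iota> S w u v = (\<Sum>(i, j)\<in>S. \<iota> (w (i, j)) * u powi i * v powi j)"

definition step_defined :: "(int \<times> int) set \<Rightarrow> 'k::field \<Rightarrow> 'k \<Rightarrow> bool" where
  "step_defined S u v \<longleftrightarrow> (\<forall>(i, j)\<in>S. (i < 0 \<longrightarrow> u \<noteq> 0) \<and> (j < 0 \<longrightarrow> v \<noteq> 0))"

definition same_step_value ::
  "('c::field \<Rightarrow> 'k::field) \<Rightarrow> (int \<times> int) set \<Rightarrow> (int \<times> int \<Rightarrow> 'c) \<Rightarrow> 'k \<times> 'k \<Rightarrow> 'k \<times> 'k \<Rightarrow> bool"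
where
  "same_step_value \<iota> S w p q \<longleftrightarrow>
     step_defined S (fst p) (snd p) \<and> step_defined S (fst q) (snd q) \<and>
     step_eval \<iota> S w (fst p) (snd p) = step_eval \<iota> S w (fst q) (snd q)"

definition sim_x ::
  "('c::field \<Rightarrow> 'k::field) \<Rightarrow> (int \<times> int) set \<Rightarrow> (int \<times> int \<Rightarrow> 'c) \<Rightarrow> 'k \<times> 'k \<Rightarrow> 'k \<times> 'k \<Rightarrow> bool"
where
  "sim_x \<iota> S w p q \<longleftrightarrow> fst p = fst q \<and> same_step_value \<iota> S w p q"

definition sim_y ::
  "('c::field \<Rightarrow> 'k::field) \<Rightarrow> (int \<times> int) set \<Rightarrow> (int \<times> int \<Rightarrow> 'c) \<Rightarrow> 'k \<times> 'k \<Rightarrow> 'k \<times> 'k \<Rightarrow> bool"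
where
  "sim_y \<iota> S w p q \<longleftrightarrow> snd p = snd q \<and> same_step_value \<iota> S w p q"

text \<open>Both relations are symmetric, so the closure below is an equivalence relation.\<close>

definition walk_orbit ::
  "('c::field \<Rightarrow> 'k::field) \<Rightarrow> (int \<times> int) set \<Rightarrow> (int \<times> int \<Rightarrow> 'c) \<Rightarrow> 'k \<Rightarrow> 'k \<Rightarrow> ('k \<times> 'k) set"
where
  "walk_orbit \<iota> S w x y = {q. (sup (sim_x \<iota> S w) (sim_y \<iota> S w))\<^sup>*\<^sup>* (x, y) q}"

definition base_field ::
  "('c::field \<Rightarrow> 'k::field) \<Rightarrow> (int \<times> int) set \<Rightarrow> (int \<times> int \<Rightarrow> 'c) \<Rightarrow> 'k \<Rightarrow> 'k \<Rightarrow> 'k set" where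
  "base_field \<iota> S w x y = field_adjoin (range \<iota>) {step_eval \<iota> S w x y}"

definition orbit_field ::
  "('c::field \<Rightarrow> 'k::field) \<Rightarrow> (int \<times> int) set \<Rightarrow> (int \<times> int \<Rightarrow> 'c) \<Rightarrow> 'k \<Rightarrow> 'k \<Rightarrow> 'k set" where
  "orbit_field \<iota> S w x y =
     field_adjoin (base_field \<iota> S w x y) (fst ` walk_orbit \<iota> S w x y \<union> snd ` walk_orbit \<iota> S w x y)"

end

theory Submission
  imports Defs
begin

text \<open>
  Let \<open>L = k(O)\<close> and let \<open>M\<close> be one of \<open>k(x)\<close>, \<open>k(y)\<close>, \<open>k(x, y)\<close>. As \<open>S\<close> is not univariate, each
  of \<open>x\<close>, \<open>y\<close> is algebraic over \<open>k\<close> and the other one, so the whole algebraically closed field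
  is algebraic over \<open>M\<close>. In characteristic zero, every \<open>z \<notin> M\<close> is then moved by an automorphism \<open>\<sigma>\<close> of the
  ambient field over \<open>M\<close>: send \<open>z\<close> to another root of its minimal polynomial and extend by Zorn's
  lemma. Since \<open>\<sigma>\<close> fixes \<open>S(x, y)\<close> and at least one of \<open>x\<close>, \<open>y\<close>, the pair \<open>(\<sigma> x, \<sigma> y)\<close> is
  adjacent to \<open>(x, y)\<close>; hence \<open>\<sigma>\<close> permutes the orbit and restricts to an automorphism of \<open>L\<close>.
\<close>

section \<open>Subfields\<close>

lemma is_subfieldD:
  assumes "is_subfield F"
  shows "0 \<in> F" "1 \<in> F" "a \<in> F \<Longrightarrow> b \<in> F \<Longrightarrow> a + b \<in> F" "a \<in> F \<Longrightarrow> - a \<in> F"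
    "a \<in> F \<Longrightarrow> b \<in> F \<Longrightarrow> a * b \<in> F" "a \<in> F \<Longrightarrow> inverse a \<in> F"
  using assms unfolding is_subfield_def by auto

lemma is_subfield_diff: "is_subfield F \<Longrightarrow> a \<in> F \<Longrightarrow> b \<in> F \<Longrightarrow> a - b \<in> F"
  using is_subfieldD(3)[of F a "- b"] is_subfieldD(4)[of F b] by simp

lemma is_subfield_divide: "is_subfield F \<Longrightarrow> a \<in> F \<Longrightarrow> b \<in> F \<Longrightarrow> a / b \<in> F"
  by (simp add: divide_inverse is_subfieldD)

lemma is_subfield_sum: "is_subfield F \<Longrightarrow> (\<And>i. i \<in> I \<Longrightarrow> f i \<in> F) \<Longrightarrow> sum f I \<in> F"
  by (induction I rule: infinite_finite_induct) (auto simp: is_subfieldD)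

lemma is_subfield_power: "is_subfield F \<Longrightarrow> a \<in> F \<Longrightarrow> a ^ n \<in> F"
  by (induction n) (auto simp: is_subfieldD)

lemma is_subfield_power_int: "is_subfield F \<Longrightarrow> a \<in> F \<Longrightarrow> a powi i \<in> F"
  by (simp add: power_int_def is_subfieldD is_subfield_power)

lemma is_subfield_of_nat: "is_subfield F \<Longrightarrow> of_nat n \<in> F"
  by (induction n) (auto simp: is_subfieldD)

lemma is_subfield_field_adjoin: "is_subfield (field_adjoin M A)"
  unfolding field_adjoin_def is_subfield_def by blast

lemma field_adjoin_superset: "M \<subseteq> field_adjoin M A" "A \<subseteq> field_adjoin M A"
  unfolding field_adjoin_def by blast+

lemma field_adjoin_least: "is_subfield F \<Longrightarrow> M \<subseteq> F \<Longrightarrow> A \<subseteq> F \<Longrightarrow> field_adjoin M A \<subseteq> F"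
  unfolding field_adjoin_def by blast

lemma algebraic_over_mono: "algebraic_over F z \<Longrightarrow> F \<subseteq> G \<Longrightarrow> algebraic_over G z"
  unfolding algebraic_over_def by blast

section \<open>Field embeddings\<close>

text \<open>A nonzero element is a unit, hence so is its image; this gives the trivial kernel and
  injectivity. The clause for \<open>inverse\<close> covers 0 because
  \<open>inverse 0 = 0\<close>.\<close>

lemma field_embedding_props:
  assumes "field_embedding f"
  shows "f 1 = 1" "f (a + b) = f a + f b" "f (a * b) = f a * f b" "f 0 = 0" "f (- a) = - f a"
    "f (inverse a) = inverse (f a)" "f a = 0 \<longleftrightarrow> a = 0"
    "inj f"
proof -
  show 1: "f 1 = 1" and add: "f (a + b) = f a + f b" and mult: "f (a * b) = f a * f b" for a b
    using assms unfolding field_embedding_def by auto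
  show 0: "f 0 = 0" using add[of 0 0] by (metis add.right_neutral add_left_imp_eq)
  show m: "f (- a) = - f a" for a using add[of a "- a"] 0 by (simp add: add_eq_0_iff)
  have nz: "f a * f (inverse a) = 1" if "a \<noteq> 0" for a
    using mult[of a "inverse a"] 1 that by simp
  show z: "f a = 0 \<longleftrightarrow> a = 0" for a using nz[of a] 0 by (metis mult_zero_left zero_neq_one)
  show "f (inverse a) = inverse (f a)"
    using nz[of a] 0 inverse_unique[of "f a" "f (inverse a)"] by (cases "a = 0") auto
  show "inj f"
  proof (rule injI)
    fix a b assume "f a = f b"
    then have "f (a + (- b)) = 0" by (simp only: add m) simp
    then show "a = b" using z[of "a + (- b)"] by simp
  qed
qed

context
  fixes f :: "'a::field \<Rightarrow> 'b::field"
  assumes f: "field_embedding f"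
begin

lemma field_embedding_of_nat: "f (of_nat n) = of_nat n"
  by (induction n) (simp_all add: field_embedding_props(1,2,4)[OF f])

lemma field_embedding_sum: "f (sum g I) = (\<Sum>i\<in>I. f (g i))"
  by (induction I rule: infinite_finite_induct) (simp_all add: field_embedding_props(2,4)[OF f])

lemma field_embedding_power: "f (a ^ n) = f a ^ n"
  by (induction n) (simp_all add: field_embedding_props(1,3)[OF f])

lemma field_embedding_power_int: "f (a powi i) = f a powi i"
  by (simp add: power_int_def field_embedding_power field_embedding_props(6)[OF f])

lemma is_subfield_vimage: "is_subfield F \<Longrightarrow> is_subfield (f -` F)"
  unfolding is_subfield_def by (simp add: field_embedding_props(1-6)[OF f])

end

lemma is_subfield_range:
  assumes "field_embedding f"
  shows "is_subfield (range f)"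
proof -
  note p = field_embedding_props[OF assms]
  show ?thesis unfolding is_subfield_def
    using p(1,4)[symmetric] by (auto simp flip: p(2,3,5,6))
qed

lemma field_embedding_inv:
  assumes "field_embedding f" "bij f"
  shows "field_embedding (inv f)"
proof -
  have "f (inv f a) = a" for a using assms(2) by (simp add: bij_is_surj surj_f_inv_f)
  then show ?thesis
    unfolding field_embedding_def
    using field_embedding_props(1-3)[OF assms(1)] injD[OF field_embedding_props(8)[OF assms(1)]]
    by simp
qed

section \<open>Transitivity of algebraicity\<close>

text \<open>The \<open>F\<close>-linear span of an indexed family. Indexing lets \<open>I\<close> be
  a set of exponents or of pairs of exponents, where coinciding vectors do no harm.\<close>

definition subspan :: "'k::field set \<Rightarrow> 'i set \<Rightarrow> ('i \<Rightarrow> 'k) \<Rightarrow> 'k set" where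
  "subspan F I v = {(\<Sum>i\<in>I. c i * v i) |c. \<forall>i\<in>I. c i \<in> F}"

lemma subspanI: "(\<And>i. i \<in> I \<Longrightarrow> c i \<in> F) \<Longrightarrow> (\<Sum>i\<in>I. c i * v i) \<in> subspan F I v"
  unfolding subspan_def by blast

lemma subspan_add:
  assumes "is_subfield F" "a \<in> subspan F I v" "b \<in> subspan F I v"
  shows "a + b \<in> subspan F I v"
proof -
  obtain c d where "\<forall>i\<in>I. c i \<in> F" "\<forall>i\<in>I. d i \<in> F"
    and "a = (\<Sum>i\<in>I. c i * v i)" "b = (\<Sum>i\<in>I. d i * v i)"
    using assms unfolding subspan_def by blast
  then show ?thesis
    using subspanI[of I "\<lambda>i. c i + d i" F v] is_subfieldD(3)[OF assms(1)]
    by (simp add: sum.distrib distrib_right)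
qed

lemma subspan_scale:
  assumes "is_subfield F" "a \<in> subspan F I v" "r \<in> F"
  shows "r * a \<in> subspan F I v"
proof -
  obtain c where "\<forall>i\<in>I. c i \<in> F" and "a = (\<Sum>i\<in>I. c i * v i)"
    using assms unfolding subspan_def by blast
  then show ?thesis
    using subspanI[of I "\<lambda>i. r * c i" F v] is_subfieldD(5)[OF assms(1)] assms(3)
    by (simp add: sum_distrib_left mult.assoc)
qed

lemma subspan_0: "is_subfield F \<Longrightarrow> 0 \<in> subspan F I v"
  using subspanI[of I "\<lambda>_. 0" F v] by (simp add: is_subfieldD)

lemma subspan_sum:
  "is_subfield F \<Longrightarrow> (\<And>j. j \<in> J \<Longrightarrow> f j \<in> subspan F I v) \<Longrightarrow> sum f J \<in> subspan F I v"
  by (induction J rule: infinite_finite_induct) (auto simp: subspan_0 subspan_add)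

lemma subspan_base:
  assumes "is_subfield F" "finite I" "i \<in> I"
  shows "v i \<in> subspan F I v"
proof -
  have "(\<Sum>j\<in>I. (if j = i then 1 else 0) * v j) \<in> subspan F I v"
    by (rule subspanI) (auto simp: is_subfieldD assms)
  also have "(\<Sum>j\<in>I. (if j = i then 1 else 0) * v j) = (\<Sum>j\<in>I. if j = i then v i else 0)"
    by (rule sum.cong) auto
  also have "\<dots> = v i" using assms by simp
  finally show ?thesis .
qed

text \<open>Gaussian elimination by induction on \<open>I\<close>: a vector \<open>u k\<close> with
  nonzero coefficient at \<open>v i\<close> serves as pivot to remove \<open>v i\<close> from the
  others, leaving one vector and one generator fewer.\<close>

lemma subspan_dependent:
  assumes F: "is_subfield F" and "finite I" "finite J" "card I < card J"
    and "\<And>j. j \<in> J \<Longrightarrow> u j \<in> subspan F I v"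
  shows "\<exists>d. (\<forall>j\<in>J. d j \<in> F) \<and> (\<exists>j\<in>J. d j \<noteq> 0) \<and> (\<Sum>j\<in>J. d j * u j) = 0"
  using assms(2-5)
proof (induction I arbitrary: J u rule: finite_induct)
  case empty
  then have "u j = 0" if "j \<in> J" for j using that unfolding subspan_def by auto
  moreover have "J \<noteq> {}" using empty by auto
  ultimately show ?case by (intro exI[of _ "\<lambda>_. 1"]) (auto simp: is_subfieldD[OF F])
next
  case (insert i I)
  have "\<forall>j\<in>J. \<exists>c u'. c \<in> F \<and> u' \<in> subspan F I v \<and> u j = c * v i + u'"
  proof
    fix j assume "j \<in> J"
    then obtain c where "\<forall>i\<in>insert i I. c i \<in> F" "u j = (\<Sum>i\<in>insert i I. c i * v i)"
      using insert.prems(3)[of j] unfolding subspan_def by blast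
    then show "\<exists>c u'. c \<in> F \<and> u' \<in> subspan F I v \<and> u j = c * v i + u'"
      using insert.hyps by (intro exI[of _ "c i"] exI[of _ "\<Sum>i\<in>I. c i * v i"]) (auto intro: subspanI)
  qed
  then obtain c u' where cu: "\<And>j. j \<in> J \<Longrightarrow> c j \<in> F" "\<And>j. j \<in> J \<Longrightarrow> u' j \<in> subspan F I v"
    "\<And>j. j \<in> J \<Longrightarrow> u j = c j * v i + u' j" by metis
  show ?case
  proof (cases "\<forall>j\<in>J. c j = 0")
    case True
    then show ?thesis using insert.IH[of J u] insert.prems insert.hyps cu by auto
  next
    case False
    then obtain k where k: "k \<in> J" "c k \<noteq> 0" by blast
    have "card I < card (J - {k})"
      using insert.prems insert.hyps k by simp
    moreover have "u j - c j / c k * u k \<in> subspan F I v" if "j \<in> J - {k}" for j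
    proof -
      have "u j - c j / c k * u k = u' j + (- (c j / c k)) * u' k"
        using that k cu(3)[of j] cu(3)[of k] by (simp add: field_simps)
      moreover have "- (c j / c k) \<in> F"
        using that k by (auto intro!: is_subfieldD(4)[OF F] is_subfield_divide[OF F] cu(1))
      ultimately show ?thesis
        using that k by (metis DiffD1 cu(2) subspan_add[OF F] subspan_scale[OF F])
    qed
    ultimately obtain d where d: "\<forall>j\<in>J - {k}. d j \<in> F" "\<exists>j\<in>J - {k}. d j \<noteq> 0"
      "(\<Sum>j\<in>J - {k}. d j * (u j - c j / c k * u k)) = 0"
      using insert.IH[of "J - {k}" "\<lambda>j. u j - c j / c k * u k"] insert.prems(1) by auto
    \<comment> \<open>A relation among the reduced vectors becomes one among the \<open>u j\<close>
      once the multiples of the pivot are collected in its own coefficient.\<close>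
    define e where "e = d(k := - (\<Sum>j\<in>J - {k}. d j * (c j / c k)))"
    have "(\<Sum>j\<in>J. e j * u j) = e k * u k + (\<Sum>j\<in>J - {k}. d j * u j)"
      using sum.remove[OF insert.prems(1) k(1), of "\<lambda>j. e j * u j"] by (simp add: e_def)
    also have "\<dots> = (\<Sum>j\<in>J - {k}. d j * (u j - c j / c k * u k))"
      by (simp add: e_def right_diff_distrib sum_subtractf sum_distrib_right mult.assoc)
    finally have "(\<Sum>j\<in>J. e j * u j) = 0" using d(3) by simp
    moreover have "e j \<in> F" if "j \<in> J" for j
      using that d(1) k cu(1) unfolding e_def
      by (auto intro!: is_subfieldD(4,5)[OF F] is_subfield_sum[OF F] is_subfield_divide[OF F])
    moreover have "\<exists>j\<in>J. e j \<noteq> 0" using d(2) by (auto simp: e_def)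
    ultimately show ?thesis by blast
  qed
qed

text \<open>The \<open>card I + 1\<close> powers of \<open>z\<close> with exponents up to
  \<open>card I\<close> are too many to be independent; a relation among them is the required
  polynomial.\<close>

lemma algebraic_over_if_powers_in_subspan:
  assumes F: "is_subfield F" and I: "finite I" and z: "\<And>n. z ^ n \<in> subspan F I v"
  shows "algebraic_over F z"
proof -
  obtain d where d: "\<forall>j\<in>{..card I}. d j \<in> F" "\<exists>j\<in>{..card I}. d j \<noteq> 0"
    "(\<Sum>j\<in>{..card I}. d j * z ^ j) = 0"
    using subspan_dependent[OF F I, of "{..card I}" "\<lambda>j. z ^ j" v] z by auto
  define p where "p = (\<Sum>j\<in>{..card I}. monom (d j) j)"
  have cf: "coeff p i = (if i \<le> card I then d i else 0)" for i
    by (simp add: p_def coeff_sum)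
  have "p \<noteq> 0" using d(2) cf by (metis atMost_iff coeff_0)
  moreover have "poly p z = 0" using d(3) by (simp add: p_def poly_sum poly_monom)
  ultimately show ?thesis unfolding algebraic_over_def
    using cf d(1) is_subfieldD(1)[OF F] by (intro exI[of _ p]) auto
qed

lemma subspan_power_closed:
  assumes F: "is_subfield F"
    and z: "\<And>i. i \<in> I \<Longrightarrow> z * v i \<in> subspan F I v"
  shows "a \<in> subspan F I v \<Longrightarrow> z ^ n * a \<in> subspan F I v"
proof (induction n)
  case (Suc n)
  then obtain c where c: "\<forall>i\<in>I. c i \<in> F" "z ^ n * a = (\<Sum>i\<in>I. c i * v i)"
    unfolding subspan_def by blast
  then have "z ^ Suc n * a = (\<Sum>i\<in>I. c i * (z * v i))"
    by (simp add: sum_distrib_left mult.assoc mult.left_commute)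
  also have "\<dots> \<in> subspan F I v"
    by (intro subspan_sum[OF F] subspan_scale[OF F] z) (use c in blast)+
  finally show ?case .
qed simp

section \<open>Simple algebraic extensions and towers\<close>

lemma algebraic_over_reduce_power:
  assumes F: "is_subfield F" and "algebraic_over F z"
  obtains d c where "d > 0" "\<And>i. c i \<in> F" "z ^ d = (\<Sum>i<d. c i * z ^ i)"
proof -
  obtain p where p: "p \<noteq> 0" "\<And>i. coeff p i \<in> F" "poly p z = 0"
    using assms unfolding algebraic_over_def by blast
  define d where "d = degree p"
  define l where "l = lead_coeff p"
  have l: "l \<noteq> 0" "l \<in> F" using p by (auto simp: l_def)
  have "d > 0"
  proof (rule ccontr)
    assume "\<not> d > 0"
    then obtain e where "p = [:e:]" using degree_eq_zeroE[of p] d_def by auto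
    then show False using p by simp
  qed
  moreover have "- (coeff p i / l) \<in> F" for i
    using is_subfield_divide[OF F p(2) l(2)] is_subfieldD(4)[OF F] by blast
  moreover have "z ^ d = (\<Sum>i<d. - (coeff p i / l) * z ^ i)"
  proof -
    have "0 = (\<Sum>i<d. coeff p i * z ^ i) + l * z ^ d"
      using p(3) by (simp add: poly_altdef d_def l_def flip: lessThan_Suc_atMost)
    then have "z ^ d = - (\<Sum>i<d. coeff p i * z ^ i) / l"
      using l by (simp add: field_simps eq_neg_iff_add_eq_0)
    then show ?thesis
      by (simp add: sum_divide_distrib sum_negf)
  qed
  ultimately show thesis by (rule that)
qed

text \<open>Factors of the variable can be removed since the root is nonzero. The nonzero constant
  term later yields inverses and trivial kernels.\<close>

lemma algebraic_over_nonzero_constant_coeff: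
  assumes "algebraic_over F r" "r \<noteq> 0"
  obtains p where "\<And>i. coeff p i \<in> F" "coeff p 0 \<noteq> 0" "poly p r = 0"
proof -
  obtain p where p: "p \<noteq> 0" "\<And>i. coeff p i \<in> F" "poly p r = 0"
    using assms unfolding algebraic_over_def by blast
  have "\<exists>q. (\<forall>i. coeff q i \<in> F) \<and> coeff q 0 \<noteq> 0 \<and> poly q r = 0"
    using p
  proof (induction p)
    case (pCons a p)
    show ?case
    proof (cases "a = 0")
      case True
      then have "p \<noteq> 0" "poly p r = 0" using pCons.prems assms(2) by auto
      moreover have "coeff p i \<in> F" for i using pCons.prems(2)[of "Suc i"] by simp
      ultimately show ?thesis using pCons.IH by blast
    next
      case False
      then show ?thesis using pCons.prems by (intro exI[of _ "pCons a p"]) auto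
    qed
  qed simp
  then show thesis using that by blast
qed

text \<open>The span of the first \<open>d\<close> powers of \<open>y\<close> contains
  \<open>F\<close> and \<open>y\<close> and is itself a field. Multiplication by \<open>y\<close>
  pushes only the last generator out of the list, and the relation for \<open>y ^ d\<close> brings
  it back.\<close>

lemma field_adjoin_subset_subspan_powers:
  assumes F: "is_subfield F" and d: "d > 0" and c: "\<And>i. c i \<in> F"
    and y: "y ^ d = (\<Sum>i<d. c i * y ^ i)"
  shows "field_adjoin F {y} \<subseteq> subspan F {..<d} (\<lambda>i. y ^ i)"
proof -
  define W where "W = subspan F {..<d} (\<lambda>i. y ^ i)"
  have yi: "y ^ i \<in> W" if "i < d" for i
    using subspan_base[OF F, of "{..<d}" i "\<lambda>i. y ^ i"] that by (simp add: W_def)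
  have one: "1 \<in> W" using yi[of 0] d by simp
  have W_y: "y * y ^ i \<in> W" if "i \<in> {..<d}" for i
  proof (cases "Suc i < d")
    case True then show ?thesis using yi[of "Suc i"] by simp
  next
    case False
    then have "y * y ^ i = y ^ d" using that by (metis lessThan_iff not_less_eq less_antisym power_Suc)
    then show ?thesis unfolding W_def using c by (simp add: y subspanI)
  qed
  have pow: "y ^ n * a \<in> W" if "a \<in> W" for n a
    using subspan_power_closed[OF F, of "{..<d}" y "\<lambda>i. y ^ i"] W_y that by (simp add: W_def)
  have mult: "a * b \<in> W" if ab: "a \<in> W" "b \<in> W" for a b
  proof -
    obtain e where e: "\<forall>i\<in>{..<d}. e i \<in> F" "a = (\<Sum>i<d. e i * y ^ i)"
      using ab unfolding W_def subspan_def by blast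
    have "a * b = (\<Sum>i<d. e i * (y ^ i * b))"
      by (simp add: e sum_distrib_right mult.assoc)
    also have "\<dots> \<in> W" unfolding W_def
      by (intro subspan_sum[OF F] subspan_scale[OF F] pow[OF ab(2), unfolded W_def]) (use e in blast)
    finally show ?thesis .
  qed
  have scal: "a \<in> W" if "a \<in> F" for a
    using subspan_scale[OF F one[unfolded W_def] that] by (simp add: W_def)
  have add: "a + b \<in> W" if "a \<in> W" "b \<in> W" for a b
    using subspan_add[OF F] that unfolding W_def by blast
  \<comment> \<open>All powers of \<open>r\<close> lie in the span, so \<open>r\<close> is
    algebraic; a relation \<open>a + r * poly q r = 0\<close> with \<open>a\<close> nonzero exhibits
    the inverse as a polynomial in \<open>r\<close>.\<close>
  have inv: "inverse r \<in> W" if r: "r \<in> W" for r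
  proof (cases "r = 0")
    case False
    have rn: "r ^ n \<in> W" for n by (induction n) (auto simp: one mult r)
    then have "algebraic_over F r"
      using algebraic_over_if_powers_in_subspan[OF F, of "{..<d}" r "\<lambda>i. y ^ i"] by (simp add: W_def)
    then obtain p where p: "\<And>i. coeff p i \<in> F" "coeff p 0 \<noteq> 0" "poly p r = 0"
      using algebraic_over_nonzero_constant_coeff[OF _ False] by blast
    obtain a q where q: "p = pCons a q" by (cases p)
    have "poly q r \<in> W"
      unfolding poly_altdef
    proof (subst W_def, rule subspan_sum[OF F], fold W_def)
      fix i show "coeff q i * r ^ i \<in> W"
        using mult[OF scal rn, of "coeff q i" i] p(1)[of "Suc i"] q by simp
    qed
    moreover have "a \<in> F" "a \<noteq> 0" using p(1)[of 0] p(2) q by auto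
    moreover have "inverse r = - inverse a * poly q r"
    proof -
      have "a + r * poly q r = 0" using p(3) q by simp
      then have "r * poly q r = - a" by (simp add: add_eq_0_iff)
      then have "r * (- inverse a * poly q r) = - inverse a * - a" by (metis mult.left_commute)
      also have "\<dots> = 1" using \<open>a \<noteq> 0\<close> by simp
      finally have "r * (- inverse a * poly q r) = 1" .
      then show ?thesis by (rule inverse_unique)
    qed
    ultimately show ?thesis
      using scal[of "- inverse a"] is_subfieldD(4,6)[OF F] mult by metis
  qed (use subspan_0[OF F] in \<open>simp add: W_def\<close>)
  have "- a \<in> W" if "a \<in> W" for a
    using mult[OF scal[of "- 1"] that] is_subfieldD(2,4)[OF F] by simp
  then have "is_subfield W"
    unfolding is_subfield_def using scal[OF is_subfieldD(1)[OF F]] one add mult inv by simp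
  moreover have "y \<in> W" using W_y[of 0] d by simp
  ultimately show ?thesis using field_adjoin_least[of W F "{y}"] scal by (auto simp: W_def)
qed

text \<open>The products \<open>y ^ i * z ^ j\<close> with \<open>i < d\<close> and
  \<open>j < e\<close> span a space over \<open>F\<close> that contains 1 and is stable under
  multiplication by \<open>z\<close>, so it contains all powers of \<open>z\<close>.\<close>

lemma algebraic_over_trans:
  assumes F: "is_subfield F" and y: "algebraic_over F y"
    and z: "algebraic_over (field_adjoin F {y}) z"
  shows "algebraic_over F z"
proof -
  obtain d c where d: "d > 0" "\<And>i. c i \<in> F" "y ^ d = (\<Sum>i<d. c i * y ^ i)"
    using algebraic_over_reduce_power[OF F y] by blast
  have adj: "field_adjoin F {y} \<subseteq> subspan F {..<d} (\<lambda>i. y ^ i)"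
    by (rule field_adjoin_subset_subspan_powers[OF F d])
  obtain e g where e: "e > 0" "\<And>i. g i \<in> field_adjoin F {y}" "z ^ e = (\<Sum>i<e. g i * z ^ i)"
    using algebraic_over_reduce_power[OF is_subfield_field_adjoin z] by blast
  define I where "I = {..<d} \<times> {..<e}"
  define v where "v = (\<lambda>(i, j). y ^ i * z ^ j)"
  have fin: "finite I" by (simp add: I_def)
  have W: "a * z ^ j \<in> subspan F I v" if a: "a \<in> field_adjoin F {y}" and j: "j < e" for a j
  proof -
    obtain h where h: "\<forall>i\<in>{..<d}. h i \<in> F" "a = (\<Sum>i<d. h i * y ^ i)"
      using a adj unfolding subspan_def by blast
    have "a * z ^ j = (\<Sum>i<d. h i * v (i, j))"
      by (simp add: h v_def sum_distrib_right mult.assoc)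
    also have "\<dots> \<in> subspan F I v"
      by (intro subspan_sum[OF F] subspan_scale[OF F] subspan_base[OF F fin]) (use h j in \<open>auto simp: I_def\<close>)
    finally show ?thesis .
  qed
  have one: "1 \<in> subspan F I v"
    using W[OF is_subfieldD(2)[OF is_subfield_field_adjoin] e(1)] by simp
  have yF: "y ^ i \<in> field_adjoin F {y}" for i
    using field_adjoin_superset(2)[of "{y}" F] by (auto intro: is_subfield_power is_subfield_field_adjoin)
  have "z * v q \<in> subspan F I v" if q: "q \<in> I" for q
  proof -
    obtain i j where ij: "q = (i, j)" "i < d" "j < e" using q by (auto simp: I_def)
    have eq: "z * v q = y ^ i * z ^ Suc j" by (simp add: ij v_def mult.left_commute)
    show ?thesis
    proof (cases "Suc j < e")
      case True
      then show ?thesis unfolding eq by (intro W yF)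
    next
      case False
      then have "z * v q = y ^ i * z ^ e" using ij eq less_antisym[of e j] by (metis linorder_neqE_nat not_less_eq)
      also have "\<dots> = (\<Sum>k<e. (y ^ i * g k) * z ^ k)"
        by (simp add: e(3) sum_distrib_left mult.assoc)
      also have "\<dots> \<in> subspan F I v"
        by (intro subspan_sum[OF F] W is_subfieldD(5)[OF is_subfield_field_adjoin] yF e(2)) auto
      finally show ?thesis .
    qed
  qed
  then have "z ^ n \<in> subspan F I v" for n
    using subspan_power_closed[OF F _ one, of z n] by simp
  then show ?thesis using algebraic_over_if_powers_in_subspan[OF F fin] by blast
qed

section \<open>Extension of partial homomorphisms\<close>

text \<open>
  Partial ring homomorphisms over \<open>M\<close> are represented by their graphs. Their domains are only
  required to be subrings: as all elements are algebraic over \<open>M\<close>, they are automatically fields.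
\<close>

definition hom_graph :: "'k::field set \<Rightarrow> ('k \<times> 'k) set \<Rightarrow> bool" where
  "hom_graph M G \<longleftrightarrow> Id_on M \<subseteq> G \<and> single_valued G \<and>
     (\<forall>a a' b b'. (a, a') \<in> G \<longrightarrow> (b, b') \<in> G \<longrightarrow> (a + b, a' + b') \<in> G \<and> (a * b, a' * b') \<in> G)"

lemma hom_graphD:
  assumes "hom_graph M G"
  shows "a \<in> M \<Longrightarrow> (a, a) \<in> G" "(a, a') \<in> G \<Longrightarrow> (a, a'') \<in> G \<Longrightarrow> a' = a''"
    "(a, a') \<in> G \<Longrightarrow> (b, b') \<in> G \<Longrightarrow> (a + b, a' + b') \<in> G"
    "(a, a') \<in> G \<Longrightarrow> (b, b') \<in> G \<Longrightarrow> (a * b, a' * b') \<in> G"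
  using assms unfolding hom_graph_def by (auto dest: single_valuedD)

lemma hom_graph_Id_on: "is_subfield M \<Longrightarrow> hom_graph M (Id_on M)"
  unfolding hom_graph_def by (auto simp: is_subfieldD single_valued_def)

lemma hom_graph_diff:
  assumes M: "is_subfield M" and G: "hom_graph M G" and "(a, a') \<in> G" "(b, b') \<in> G"
  shows "(a - b, a' - b') \<in> G"
proof -
  have "(- 1, - 1) \<in> G" using hom_graphD(1)[OF G] is_subfieldD[OF M] by blast
  then have "(a + - 1 * b, a' + - 1 * b') \<in> G" using hom_graphD(3,4)[OF G] assms(3,4) by blast
  then show ?thesis by simp
qed

lemma hom_graph_sum:
  assumes M: "is_subfield M" and G: "hom_graph M G" and "\<And>i. i \<in> I \<Longrightarrow> (f i, g i) \<in> G"
  shows "(sum f I, sum g I) \<in> G"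
  using assms(3)
proof (induction I rule: infinite_finite_induct)
  case (insert i I)
  then show ?case using hom_graphD(3)[OF G, of "f i" "g i" "sum f I" "sum g I"] by simp
qed (simp_all add: hom_graphD(1)[OF G is_subfieldD(1)[OF M]])

lemma hom_graph_power:
  assumes M: "is_subfield M" and G: "hom_graph M G" and "(a, a') \<in> G"
  shows "(a ^ n, a' ^ n) \<in> G"
  by (induction n)
    (simp_all add: hom_graphD(1)[OF G is_subfieldD(2)[OF M]] hom_graphD(4)[OF G assms(3)])

section \<open>Polynomials transported along a partial homomorphism\<close>

text \<open>\<open>p'\<close> is the image of \<open>p\<close> under the partial homomorphism with
  graph \<open>G\<close>. Vanishing coefficients are included, so \<open>G\<close> must contain
  \<open>(0, 0)\<close>.\<close>

definition poly_rel :: "('k::field \<times> 'k) set \<Rightarrow> 'k poly \<Rightarrow> 'k poly \<Rightarrow> bool" where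
  "poly_rel G p p' \<longleftrightarrow> (\<forall>i. (coeff p i, coeff p' i) \<in> G)"

lemma poly_rel_pCons: "(a, a') \<in> G \<Longrightarrow> poly_rel G p p' \<Longrightarrow> poly_rel G (pCons a p) (pCons a' p')"
  unfolding poly_rel_def by (auto simp: coeff_pCons split: nat.split)

lemma poly_rel_monom:
  assumes M: "is_subfield M" and G: "hom_graph M G" and "(a, a') \<in> G"
  shows "poly_rel G (monom a n) (monom a' n)"
  using assms(3) hom_graphD(1)[OF G is_subfieldD(1)[OF M]] unfolding poly_rel_def by simp

lemma poly_rel_add:
  assumes G: "hom_graph M G" and "poly_rel G p p'" "poly_rel G q q'"
  shows "poly_rel G (p + q) (p' + q')"
  using assms(2,3) hom_graphD(3)[OF G] unfolding poly_rel_def by simp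

lemma poly_rel_diff:
  assumes M: "is_subfield M" and G: "hom_graph M G" and "poly_rel G p p'" "poly_rel G q q'"
  shows "poly_rel G (p - q) (p' - q')"
  using assms(3,4) hom_graph_diff[OF M G] unfolding poly_rel_def by simp

lemma poly_rel_mult:
  assumes M: "is_subfield M" and G: "hom_graph M G" and "poly_rel G p p'" "poly_rel G q q'"
  shows "poly_rel G (p * q) (p' * q')"
  unfolding poly_rel_def coeff_mult
  by (intro allI hom_graph_sum[OF M G] hom_graphD(4)[OF G]) (use assms(3,4) in \<open>auto simp: poly_rel_def\<close>)

lemma hom_graph_poly:
  assumes M: "is_subfield M" and G: "hom_graph M G"
    and p: "\<And>i. coeff p i \<in> M" and a: "(a, a') \<in> G"
  shows "(poly p a, poly p a') \<in> G"
  unfolding poly_altdef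
  by (intro hom_graph_sum[OF M G] hom_graphD(1,4)[OF G] hom_graph_power[OF M G] p a)

text \<open>If a nonzero \<open>a\<close> went to 0, a polynomial over \<open>M\<close> with root
  \<open>a\<close> and nonzero constant term would, its coefficients being fixed, also have the root
  0.\<close>

lemma hom_graph_eq_0:
  assumes M: "is_subfield M" and G: "hom_graph M G" and alg: "\<And>z. algebraic_over M z"
    and a: "(a, a') \<in> G"
  shows "a' = 0 \<longleftrightarrow> a = 0"
proof
  have 0: "(0, 0) \<in> G" using hom_graphD(1)[OF G] is_subfieldD(1)[OF M] by blast
  show "a' = 0" if "a = 0" using hom_graphD(2)[OF G] 0 a that by blast
  show "a = 0" if "a' = 0"
  proof (rule ccontr)
    assume "a \<noteq> 0"
    then obtain p where p: "\<And>i. coeff p i \<in> M" "coeff p 0 \<noteq> 0" "poly p a = 0"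
      using algebraic_over_nonzero_constant_coeff[OF alg] by blast
    have "poly p a' = 0"
      using hom_graph_poly[OF M G p(1) a] p(3) 0 hom_graphD(2)[OF G] by auto
    then show False using that p(2) by (simp add: poly_0_coeff_0)
  qed
qed

section \<open>Annihilating polynomials of least degree\<close>

definition annihilates :: "'k::field set \<Rightarrow> 'k poly \<Rightarrow> 'k \<Rightarrow> bool" where
  "annihilates F p a \<longleftrightarrow> p \<noteq> 0 \<and> (\<forall>i. coeff p i \<in> F) \<and> poly p a = 0"

text \<open>A minimal polynomial without monic normalisation: \<open>F\<close> will be the domain of
  a partial homomorphism, which is only required to be a subring.\<close>

definition minimal_annihilator :: "'k::field set \<Rightarrow> 'k poly \<Rightarrow> 'k \<Rightarrow> bool" where
  "minimal_annihilator F p a \<longleftrightarrow> annihilates F p a \<and> (\<forall>q. annihilates F q a \<longrightarrow> degree p \<le> degree q)"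

lemma minimal_annihilator_exists:
  assumes "algebraic_over F a"
  obtains p where "minimal_annihilator F p a"
proof -
  have "\<exists>p. annihilates F p a" using assms unfolding algebraic_over_def annihilates_def .
  then have "\<exists>p. minimal_annihilator F p a"
    unfolding minimal_annihilator_def using ex_has_least_nat[of "\<lambda>p. annihilates F p a" _ degree] by metis
  then show thesis using that by blast
qed

lemma annihilates_degree_pos:
  assumes "annihilates F p a"
  shows "degree p > 0"
proof (rule ccontr)
  assume "\<not> degree p > 0"
  then obtain c where "p = [:c:]" using degree_eq_zeroE[of p] by auto
  then show False using assms unfolding annihilates_def by auto
qed

text \<open>This makes sending \<open>poly p a\<close> to \<open>poly p' b\<close> well defined. The
  proof is pseudo-division by \<open>m\<close>: multiplying by the leading coefficient of
  \<open>m\<close> avoids division in the domain of \<open>G\<close>.\<close>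

lemma poly_rel_kernel:
  assumes M: "is_subfield M" and G: "hom_graph M G" and alg: "\<And>z. algebraic_over M z"
    and m: "minimal_annihilator (Domain G) m a" "poly_rel G m m'" "poly m' b = 0"
    and p: "poly_rel G p p'" "poly p a = 0"
  shows "poly p' b = 0"
  using p
proof (induction "degree p" arbitrary: p p' rule: less_induct)
  case less
  have 0: "(0, 0) \<in> G" using hom_graphD(1)[OF G] is_subfieldD(1)[OF M] by blast
  show ?case
  proof (cases "p = 0")
    case True
    then have "coeff p' i = 0" for i
      using less.prems(1) 0 hom_graphD(2)[OF G] unfolding poly_rel_def by (metis coeff_0)
    then have "p' = 0" by (intro poly_eqI) simp
    then show ?thesis by simp
  next
    case False
    have m0: "m \<noteq> 0" "poly m a = 0" "degree m > 0"
      using m(1) annihilates_degree_pos unfolding minimal_annihilator_def annihilates_def by blast+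
    have "annihilates (Domain G) p a"
      using less.prems False unfolding annihilates_def poly_rel_def by blast
    then have deg: "degree m \<le> degree p" using m(1) unfolding minimal_annihilator_def by blast
    define n where "n = degree p - degree m"
    define l l' where "l = coeff p (degree p)" and "l' = coeff p' (degree p)"
    define c c' where "c = coeff m (degree m)" and "c' = coeff m' (degree m)"
    have lc: "(l, l') \<in> G" "(c, c') \<in> G"
      using less.prems(1) m(2) unfolding poly_rel_def l_def l'_def c_def c'_def by blast+
    have "c \<noteq> 0" using m0 by (simp add: c_def)
    \<comment> \<open>Injectivity keeps the transported leading coefficient nonzero, so it can be
      cancelled at the end.\<close>
    then have c': "c' \<noteq> 0" using hom_graph_eq_0[OF M G alg lc(2)] by simp
    \<comment> \<open>The terms of degree \<open>degree p\<close> cancel, both having coefficient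
      \<open>c * l\<close>; \<open>r'\<close> is the same combination of the transported
      data.\<close>
    define r where "r = monom c 0 * p - monom l n * m"
    define r' where "r' = monom c' 0 * p' - monom l' n * m'"
    have "poly_rel G r r'" unfolding r_def r'_def
      by (intro poly_rel_diff[OF M G] poly_rel_mult[OF M G] poly_rel_monom[OF M G] lc m(2) less.prems(1))
    moreover have "poly r a = 0" unfolding r_def using less.prems(2) m0 by simp
    moreover have "r = 0 \<or> degree r < degree p"
    proof (rule eq_zero_or_degree_less)
      have "degree (monom l n * m) \<le> degree p"
        by (rule order.trans[OF degree_mult_le]) (use degree_monom_le[of l n] deg in \<open>simp add: n_def\<close>)
      moreover have "degree (monom c 0 * p) \<le> degree p"
        by (rule order.trans[OF degree_mult_le]) (use degree_monom_le[of c 0] in simp)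
      ultimately show "degree r \<le> degree p" unfolding r_def by (rule degree_diff_le[rotated])
      have "coeff (monom l n * m) (degree p) = l * c"
        using deg by (simp add: coeff_monom_mult n_def c_def)
      moreover have "coeff (monom c 0 * p) (degree p) = c * l"
        by (simp add: coeff_monom_mult l_def)
      ultimately show "coeff r (degree p) = 0" by (simp add: r_def)
    qed
    moreover have "degree p > 0" using deg m0(3) by simp
    ultimately have "poly r' b = 0" using less.hyps[of r r'] by auto
    then show ?thesis using c' m(3) unfolding r'_def by (simp add: poly_monom)
  qed
qed

text \<open>The new domain consists of the polynomial values at \<open>a\<close>, and any root
  \<open>b\<close> of the transported annihilator may be the image of \<open>a\<close>.
  Single-valuedness is \<open>poly_rel_kernel\<close> applied to a difference.\<close>

lemma hom_graph_extend:
  assumes M: "is_subfield M" and G: "hom_graph M G" and alg: "\<And>z. algebraic_over M z"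
    and m: "minimal_annihilator (Domain G) m a" "poly_rel G m m'" "poly m' b = 0"
  obtains G' where "hom_graph M G'" "G \<subseteq> G'" "(a, b) \<in> G'"
proof -
  define G' where "G' = {(poly p a, poly p' b) |p p'. poly_rel G p p'}"
  have 0: "(0, 0) \<in> G" and 1: "(1, 1) \<in> G"
    using hom_graphD(1)[OF G] is_subfieldD(1,2)[OF M] by blast+
  have rel0: "poly_rel G 0 0" using 0 by (simp add: poly_rel_def)
  have sub: "G \<subseteq> G'"
  proof safe
    fix c c' assume "(c, c') \<in> G"
    then have "poly_rel G [:c:] [:c':]" by (intro poly_rel_pCons rel0)
    then show "(c, c') \<in> G'" unfolding G'_def by force
  qed
  have "poly_rel G [:0, 1:] [:0, 1:]" by (intro poly_rel_pCons rel0 0 1)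
  then have ab: "(a, b) \<in> G'" unfolding G'_def by force
  have "single_valued G'"
  proof (rule single_valuedI)
    fix u v w assume "(u, v) \<in> G'" "(u, w) \<in> G'"
    then obtain p p' q q' where pq: "poly_rel G p p'" "poly_rel G q q'" "u = poly p a" "u = poly q a"
      "v = poly p' b" "w = poly q' b" unfolding G'_def by blast
    have "poly (p' - q') b = 0"
      by (rule poly_rel_kernel[OF M G alg m poly_rel_diff[OF M G pq(1,2)]]) (use pq in simp)
    then show "v = w" using pq by simp
  qed
  moreover have "(u + v, u' + v') \<in> G' \<and> (u * v, u' * v') \<in> G'"
    if uv: "(u, u') \<in> G'" "(v, v') \<in> G'" for u u' v v'
  proof -
    obtain p p' q q' where pq: "poly_rel G p p'" "poly_rel G q q'" "u = poly p a" "v = poly q a"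
      "u' = poly p' b" "v' = poly q' b" using uv unfolding G'_def by blast
    then show ?thesis
      using poly_rel_add[OF G pq(1,2)] poly_rel_mult[OF M G pq(1,2)] unfolding G'_def
      by (smt (verit) mem_Collect_eq poly_add poly_mult)
  qed
  moreover have "Id_on M \<subseteq> G'" using sub G unfolding hom_graph_def by blast
  ultimately have "hom_graph M G'" unfolding hom_graph_def by blast
  then show thesis using that sub ab by blast
qed

section \<open>Total extensions by Zorn's lemma\<close>

text \<open>Each closure condition involves only two pairs, and two pairs of the union lie in a
  common member of the chain.\<close>

lemma hom_graph_Union_chain:
  assumes "C \<noteq> {}" and chain: "subset.chain {G. hom_graph M G \<and> G0 \<subseteq> G} C"
  shows "hom_graph M (\<Union>C) \<and> G0 \<subseteq> \<Union>C"
proof -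
  have C: "hom_graph M G" "G0 \<subseteq> G" if "G \<in> C" for G
    using chain that unfolding subset.chain_def by auto
  have common: "\<exists>G\<in>C. p \<in> G \<and> q \<in> G" if pq: "p \<in> \<Union>C" "q \<in> \<Union>C" for p q
  proof -
    obtain X Y where "X \<in> C" "Y \<in> C" "p \<in> X" "q \<in> Y" using pq by blast
    moreover from this have "X \<subseteq> Y \<or> Y \<subseteq> X"
      using chain unfolding subset.chain_def by blast
    ultimately show ?thesis by blast
  qed
  have "single_valued (\<Union>C)"
    by (rule single_valuedI) (metis common C(1) hom_graphD(2))
  moreover have "(a + b, a' + b') \<in> \<Union>C \<and> (a * b, a' * b') \<in> \<Union>C"
    if "(a, a') \<in> \<Union>C" "(b, b') \<in> \<Union>C" for a a' b b'
    using common[OF that] C(1) hom_graphD(3,4) by (metis UnionI)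
  moreover obtain G where "G \<in> C" using assms(1) by blast
  then have "Id_on M \<subseteq> \<Union>C" "G0 \<subseteq> \<Union>C"
    using C[of G] hom_graphD(1)[of M G] by (auto simp: Id_on_iff)
  ultimately show ?thesis unfolding hom_graph_def by simp
qed

text \<open>A maximal graph above \<open>G0\<close> has full domain: the transported annihilator of
  any \<open>a\<close> has a root in the algebraically closed field, so \<open>a\<close> can be
  adjoined.\<close>

lemma hom_graph_total:
  fixes M :: "'k::alg_closed_field set"
  assumes M: "is_subfield M" and alg: "\<And>z. algebraic_over M z" and G0: "hom_graph M G0"
  shows "\<exists>\<sigma>. field_embedding \<sigma> \<and> (\<forall>a\<in>M. \<sigma> a = a) \<and> (\<forall>(a, a')\<in>G0. \<sigma> a = a')"
proof -
  have "\<exists>G\<in>{G. hom_graph M G \<and> G0 \<subseteq> G}. \<forall>X\<in>{G. hom_graph M G \<and> G0 \<subseteq> G}. G \<subseteq> X \<longrightarrow> X = G"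
  proof (rule subset_Zorn_nonempty)
    show "{G. hom_graph M G \<and> G0 \<subseteq> G} \<noteq> {}" using G0 by blast
    show "\<Union>C \<in> {G. hom_graph M G \<and> G0 \<subseteq> G}"
      if "C \<noteq> {}" "subset.chain {G. hom_graph M G \<and> G0 \<subseteq> G} C" for C
      using hom_graph_Union_chain[OF that] by simp
  qed
  then obtain G where G: "hom_graph M G" "G0 \<subseteq> G"
    and max: "\<And>X. hom_graph M X \<Longrightarrow> G \<subseteq> X \<Longrightarrow> X = G" by auto
  have "a \<in> Domain G" for a
  proof -
    have "M \<subseteq> Domain G" using hom_graphD(1)[OF G(1)] by blast
    then obtain m where m: "minimal_annihilator (Domain G) m a"
      using minimal_annihilator_exists algebraic_over_mono[OF alg] by blast
    then have ann: "annihilates (Domain G) m a" unfolding minimal_annihilator_def by blast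
    have "\<forall>i. \<exists>b. (coeff m i, b) \<in> G" using ann unfolding annihilates_def by blast
    then obtain h where h: "\<And>i. (coeff m i, h i) \<in> G" by metis
    \<comment> \<open>Transport neither creates nor destroys zero coefficients, so \<open>m'\<close>
      has the same positive degree as \<open>m\<close>, which guarantees a root.\<close>
    have h0: "h i = 0 \<longleftrightarrow> coeff m i = 0" for i
      by (rule hom_graph_eq_0[OF M G(1) alg h])
    define n where "n = degree m"
    have n: "n > 0" "coeff m n \<noteq> 0"
      using annihilates_degree_pos[OF ann] by (auto simp: n_def)
    define m' where "m' = (\<Sum>i\<le>n. monom (h i) i)"
    have cf: "coeff m' i = h i" for i
      using h0[of i] by (auto simp: m'_def coeff_sum n_def coeff_eq_0)
    obtain b where "poly m' b = 0"
      using alg_closed[of n h] n h0[of n] by (auto simp: m'_def poly_sum poly_monom)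
    moreover have "poly_rel G m m'" unfolding poly_rel_def using h cf by simp
    ultimately obtain G' where "hom_graph M G'" "G \<subseteq> G'" "(a, b) \<in> G'"
      using hom_graph_extend[OF M G(1) alg m] by blast
    then show ?thesis using max by blast
  qed
  then have "\<forall>a. \<exists>b. (a, b) \<in> G" by blast
  then obtain \<sigma> where s: "\<And>a. (a, \<sigma> a) \<in> G" by metis
  have eq: "\<sigma> a = a'" if "(a, a') \<in> G" for a a' using hom_graphD(2)[OF G(1) s that] .
  have "field_embedding \<sigma>" unfolding field_embedding_def
    by (intro conjI allI eq hom_graphD[OF G(1)] s is_subfieldD(2)[OF M])
  then show ?thesis using eq hom_graphD(1)[OF G(1)] G(2) by blast
qed

section \<open>Automorphisms of the ambient field and the Galois criterion\<close>

lemma field_embedding_poly: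
  assumes "field_embedding \<sigma>" "\<And>i. \<sigma> (coeff p i) = coeff p i"
  shows "\<sigma> (poly p a) = poly p (\<sigma> a)"
  using assms(2)
  by (simp add: poly_altdef field_embedding_sum[OF assms(1)] field_embedding_power[OF assms(1)]
      field_embedding_props(3)[OF assms(1)])

text \<open>Every \<open>a\<close> is among the finitely many roots of a polynomial over
  \<open>M\<close>, and an injective map of this finite set into itself is onto.\<close>

lemma field_embedding_bij:
  assumes \<sigma>: "field_embedding \<sigma>" "\<And>a. a \<in> M \<Longrightarrow> \<sigma> a = a" and alg: "\<And>z. algebraic_over M z"
  shows "bij \<sigma>"
proof -
  have inj: "inj \<sigma>" using field_embedding_props(8)[OF \<sigma>(1)] .
  have "a \<in> range \<sigma>" for a
  proof -
    obtain p where p: "p \<noteq> 0" "\<And>i. coeff p i \<in> M" "poly p a = 0"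
      using alg unfolding algebraic_over_def by blast
    define Z where "Z = {c. poly p c = 0}"
    have "finite Z" using p(1) poly_roots_finite Z_def by blast
    moreover have "\<sigma> ` Z \<subseteq> Z"
      using field_embedding_poly[OF \<sigma>(1) \<sigma>(2)[OF p(2)]] field_embedding_props(4)[OF \<sigma>(1)]
      unfolding Z_def by (auto simp flip: field_embedding_poly[OF \<sigma>(1) \<sigma>(2)[OF p(2)]])
    ultimately have "\<sigma> ` Z = Z" 
      using endo_inj_surj[of Z \<sigma>] inj_on_subset[OF inj subset_UNIV] by blast
    moreover have "a \<in> Z" using p by (simp add: Z_def)
    ultimately show ?thesis by blast
  qed
  then show ?thesis using inj by (auto simp: bij_def)
qed

text \<open>Separability in characteristic zero. Dividing \<open>m\<close> by the linear factor of
  \<open>z\<close> leaves \<open>q\<close>, which is nonconstant as \<open>z\<close> is not in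
  \<open>M\<close>; a root of \<open>q\<close> differs from \<open>z\<close> because
  \<open>z\<close> is a simple root of \<open>m\<close>.\<close>

lemma other_root_of_minimal_annihilator:
  fixes z :: "'k::alg_closed_field"
  assumes M: "is_subfield M" and char0: "\<And>n. of_nat (Suc n) \<noteq> (0::'k)"
    and m: "minimal_annihilator M m z" and z: "z \<notin> M"
  obtains b where "b \<noteq> z" "poly m b = 0"
proof -
  have ann: "m \<noteq> 0" "\<And>i. coeff m i \<in> M" "poly m z = 0" and pos: "degree m > 0"
    using m annihilates_degree_pos unfolding minimal_annihilator_def annihilates_def by blast+
  obtain q where q: "m = [:- z, 1:] * q" using ann(3) poly_eq_0_iff_dvd by (metis dvdE)
  have q0: "q \<noteq> 0" using ann(1) q by auto
  have degq: "degree m = Suc (degree q)" using q0 unfolding q by (subst degree_mult_eq) auto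
  have "degree q > 0"
  proof (rule ccontr)
    assume "\<not> degree q > 0"
    then obtain c where c: "q = [:c:]" using degree_eq_zeroE[of q] by auto
    then have "coeff m 0 = - z * c" "coeff m 1 = c" "c \<noteq> 0" using q q0 by auto
    then have "z = - (coeff m 0 / coeff m 1)" by simp
    then show False
      using z is_subfieldD(4)[OF M is_subfield_divide[OF M ann(2) ann(2)]] by metis
  qed
  then obtain b where b: "poly q b = 0" using alg_closed_imp_poly_has_root by blast
  moreover have "poly q z \<noteq> 0"
  proof
    assume "poly q z = 0"
    then have "poly (pderiv m) z = 0" unfolding q pderiv_mult by (simp add: pderiv_pCons)
    \<comment> \<open>This is the leading coefficient of \<open>m\<close> times its degree, nonzero
      in characteristic zero. The derivative would then annihilate \<open>z\<close> in smaller
      degree than \<open>m\<close>.\<close>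
    moreover have "coeff (pderiv m) (degree q) \<noteq> 0"
      using char0[of "degree q"] degq ann(1)
      by (metis coeff_pderiv leading_coeff_0_iff mult_eq_0_iff)
    then have "pderiv m \<noteq> 0" by auto
    moreover have "coeff (pderiv m) i \<in> M" for i
      unfolding coeff_pderiv by (intro is_subfieldD(5)[OF M] is_subfield_of_nat[OF M] ann(2))
    ultimately have "annihilates M (pderiv m) z" unfolding annihilates_def by blast
    then have "degree m \<le> degree (pderiv m)" using m unfolding minimal_annihilator_def by blast
    moreover have "degree (pderiv m) \<le> degree q"
      by (rule degree_le) (auto simp: coeff_pderiv coeff_eq_0 degq)
    ultimately show False using degq by simp
  qed
  ultimately show thesis using that[of b] q by auto
qed

lemma exists_automorphism_moving:
  fixes M :: "'k::alg_closed_field set"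
  assumes M: "is_subfield M" and alg: "\<And>z. algebraic_over M z"
    and char0: "\<And>n. of_nat (Suc n) \<noteq> (0::'k)" and z: "z \<notin> M"
  obtains \<sigma> where "field_embedding \<sigma>" "bij \<sigma>" "\<And>a. a \<in> M \<Longrightarrow> \<sigma> a = a" "\<sigma> z \<noteq> z"
proof -
  obtain m where m: "minimal_annihilator M m z" using minimal_annihilator_exists[OF alg] .
  obtain b where b: "b \<noteq> z" "poly m b = 0"
    using other_root_of_minimal_annihilator[OF M char0 m z] .
  have "poly_rel (Id_on M) m m"
    using m unfolding poly_rel_def minimal_annihilator_def annihilates_def by blast
  then obtain G where G: "hom_graph M G" "(z, b) \<in> G"
    using hom_graph_extend[OF M hom_graph_Id_on[OF M] alg _ _ b(2)] m by (metis Domain_Id_on)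
  obtain \<sigma> where \<sigma>: "field_embedding \<sigma>" "\<forall>a\<in>M. \<sigma> a = a" "\<sigma> z = b"
    using hom_graph_total[OF M alg G(1)] G(2) by fastforce
  moreover have "bij \<sigma>" using field_embedding_bij[OF \<sigma>(1) _ alg] \<sigma>(2) by blast
  ultimately show thesis using that b(1) by simp
qed

text \<open>The hypothesis \<open>stable\<close> is normality, stated for embeddings of the ambient
  field; it allows an automorphism moving a given \<open>z\<close> outside \<open>M\<close> to be
  restricted to \<open>L\<close>.\<close>

lemma galois_extension_if_stable:
  fixes L M :: "'k::alg_closed_field set"
  assumes L: "is_subfield L" and M: "is_subfield M" and sub: "M \<subseteq> L"
    and alg: "\<And>z. algebraic_over M z" and char0: "\<And>n. of_nat (Suc n) \<noteq> (0::'k)"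
    and stable: "\<And>\<sigma>. field_embedding \<sigma> \<Longrightarrow> (\<And>a. a \<in> M \<Longrightarrow> \<sigma> a = a) \<Longrightarrow> \<sigma> ` L \<subseteq> L"
  shows "galois_extension L M"
proof -
  have "\<exists>\<sigma>. field_automorphism_over M L \<sigma> \<and> \<sigma> z \<noteq> z" if z: "z \<notin> M" for z
  proof -
    obtain \<sigma> where \<sigma>: "field_embedding \<sigma>" "bij \<sigma>" "\<And>a. a \<in> M \<Longrightarrow> \<sigma> a = a" "\<sigma> z \<noteq> z"
      using exists_automorphism_moving[OF M alg char0 z] by blast
    have "inv \<sigma> a = a" if "a \<in> M" for a
      using \<sigma>(2) \<sigma>(3)[OF that] by (metis bij_is_inj inv_f_f)
    \<comment> \<open>Stability under the inverse makes the restriction of \<sigma> map onto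
      \<open>L\<close>.\<close>
    then have "inv \<sigma> ` L \<subseteq> L" by (intro stable field_embedding_inv \<sigma>)
    then have "L \<subseteq> \<sigma> ` L" using \<sigma>(2) by (auto simp: image_iff bij_is_surj surj_f_inv_f subset_iff) (metis bij_inv_eq_iff)
    moreover have "\<sigma> ` L \<subseteq> L" by (intro stable \<sigma>)
    ultimately have "bij_betw \<sigma> L L"
      using \<sigma>(2) unfolding bij_betw_def by (metis bij_is_inj inj_on_subset subset_UNIV subset_antisym)
    then have "field_automorphism_over M L \<sigma>"
      unfolding field_automorphism_over_def using \<sigma>(1,3) field_embedding_props(1-3) by blast
    then show ?thesis using \<sigma>(4) by blast
  qed
  then show ?thesis unfolding galois_extension_def field_automorphism_over_def
    using L M sub alg by blast
qed

section \<open>Laurent polynomials\<close>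

text \<open>A large power of \<open>t\<close> turns the Laurent relation into a polynomial one, in
  which \<open>a k\<close> survives as a nonzero coefficient.\<close>

lemma algebraic_over_laurent:
  assumes F: "is_subfield F" and J: "finite J" and a: "\<And>j. j \<in> J \<Longrightarrow> a j \<in> F"
    and k: "k \<in> J" "a k \<noteq> 0" and t: "t \<noteq> 0" "(\<Sum>j\<in>J. a j * t powi j) = 0"
  shows "algebraic_over F t"
proof -
  \<comment> \<open>A crude common bound that makes every shifted exponent nonnegative.\<close>
  define N where "N = nat (\<Sum>j\<in>J. \<bar>j\<bar>)"
  have N: "0 \<le> j + int N" if "j \<in> J" for j
    using member_le_sum[OF that, of abs] J by (simp add: N_def sum_nonneg)
  define p where "p = (\<Sum>j\<in>J. monom (a j) (nat (j + int N)))"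
  have cf: "coeff p n = (\<Sum>j\<in>J. if nat (j + int N) = n then a j else 0)" for n
    by (simp add: p_def coeff_sum)
  \<comment> \<open>Shifted exponents remain distinct, so no other term contributes here.\<close>
  have "coeff p (nat (k + int N)) = (\<Sum>j\<in>J. if j = k then a j else 0)"
    unfolding cf using N k(1) by (intro sum.cong) (auto simp: nat_eq_iff)
  also have "\<dots> = a k" using J k(1) by simp
  finally have "p \<noteq> 0" using k(2) by auto
  moreover have "coeff p n \<in> F" for n
    unfolding cf by (intro is_subfield_sum[OF F]) (auto simp: a is_subfieldD(1)[OF F])
  moreover have "poly p t = (\<Sum>j\<in>J. a j * t powi j) * t ^ N"
  proof -
    have "t ^ nat (j + int N) = t powi j * t ^ N" if "j \<in> J" for j
      using N[OF that] t(1) power_int_add[of t j "int N"] by (simp add: power_int_def)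
    then show ?thesis by (simp add: p_def poly_sum poly_monom sum_distrib_right mult.assoc)
  qed
  ultimately show ?thesis unfolding algebraic_over_def using t(2) by auto
qed

text \<open>Polynomials in \<open>x\<close> alone are constant in the outer variable; those in
  \<open>y\<close> alone have constant coefficients.\<close>

lemma algebraically_independent2_transcendental:
  assumes \<iota>: "field_embedding \<iota>" and ind: "algebraically_independent2 \<iota> x y"
  shows "\<not> algebraic_over (range \<iota>) x" "\<not> algebraic_over (range \<iota>) y"
proof -
  \<comment> \<open>Independence speaks of polynomials over the source of \<iota>, so those with
    coefficients in its image are pulled back first.\<close>
  have lift: "\<exists>q. q \<noteq> 0 \<and> map_poly \<iota> q = p" if "p \<noteq> 0" "\<And>i. coeff p i \<in> range \<iota>" for p
  proof -
    note inj = field_embedding_props(8)[OF \<iota>] and zero = field_embedding_props(4)[OF \<iota>]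
    have "inv \<iota> 0 = 0" using inv_f_f[OF inj, of 0] zero by simp
    then have "map_poly \<iota> (map_poly (inv \<iota>) p) = p"
      using that(2) zero by (intro poly_eqI) (simp add: coeff_map_poly f_inv_into_f)
    then show ?thesis using that(1) by (metis map_poly_0)
  qed
  have ne: "poly (map_poly (\<lambda>q. poly (map_poly \<iota> q) x) P) y \<noteq> 0" if "P \<noteq> 0" for P
    using ind that unfolding algebraically_independent2_def by blast
  show "\<not> algebraic_over (range \<iota>) x"
  proof
    assume "algebraic_over (range \<iota>) x"
    then obtain q where "q \<noteq> 0" "poly (map_poly \<iota> q) x = 0"
      using lift unfolding algebraic_over_def by metis
    then show False using ne[of "[:q:]"] by (simp add: map_poly_pCons)
  qed
  show "\<not> algebraic_over (range \<iota>) y"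
  proof
    assume "algebraic_over (range \<iota>) y"
    then obtain q where q: "q \<noteq> 0" "poly (map_poly \<iota> q) y = 0"
      using lift unfolding algebraic_over_def by metis
    have "map_poly (\<lambda>q. poly (map_poly \<iota> q) x) (map_poly (\<lambda>c. [:c:]) q) = map_poly \<iota> q"
      using field_embedding_props(4)[OF \<iota>]
      by (intro poly_eqI) (simp add: coeff_map_poly map_poly_pCons)
    moreover have "map_poly (\<lambda>c. [:c:]) q \<noteq> 0"
      using q(1) by (subst map_poly_eq_0_iff) auto
    ultimately show False using ne[of "map_poly (\<lambda>c. [:c:]) q"] q(2) by simp
  qed
qed

lemma algebraic_over_0: "is_subfield F \<Longrightarrow> algebraic_over F 0"
  unfolding algebraic_over_def
  by (intro exI[of _ "[:0, 1:]"]) (auto simp: coeff_pCons is_subfieldD split: nat.split)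

section \<open>The orbit of a walk\<close>

text \<open>Exchanging the coordinates lets the result on the second coordinate serve for the
  first.\<close>

lemma step_eval_swap:
  "step_eval \<iota> (prod.swap ` S) (w \<circ> prod.swap) v u = step_eval \<iota> S w u v"
  unfolding step_eval_def
  by (subst sum.reindex) (auto intro!: sum.cong simp: mult.assoc mult.commute mult.left_commute)

text \<open>Sorting the step polynomial by powers of \<open>v\<close> gives a Laurent relation for
  \<open>v\<close> over \<open>F\<close>. It is nontrivial: for some \<open>k \<noteq> 0\<close> the
  coefficient of \<open>v powi k\<close> is a nonzero Laurent polynomial in the transcendental
  \<open>u\<close>.\<close>

lemma algebraic_over_second_coordinate:
  assumes \<iota>: "field_embedding \<iota>" and u: "\<not> algebraic_over (range \<iota>) u" and v: "v \<noteq> 0"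
    and S: "finite S" "\<And>s. s \<in> S \<Longrightarrow> w s \<noteq> 0" "\<exists>(i, j)\<in>S. j \<noteq> 0"
    and F: "is_subfield F" "range \<iota> \<subseteq> F" "u \<in> F" "step_eval \<iota> S w u v \<in> F"
  shows "algebraic_over F v"
proof -
  note R = is_subfield_range[OF \<iota>]
  have u0: "u \<noteq> 0" using u algebraic_over_0[OF R] by blast
  obtain k where k: "k \<in> snd ` S" "k \<noteq> 0" using S(3) by force
  define s where "s = step_eval \<iota> S w u v"
  define b where "b j = (\<Sum>q | q \<in> S \<and> snd q = j. \<iota> (w q) * u powi fst q)" for j
  \<comment> \<open>The value \<open>s\<close> is absorbed at exponent 0, which \<open>J\<close>
    therefore contains even if no step has it; as \<open>k \<noteq> 0\<close>, \<open>a k\<close>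
    equals \<open>b k\<close>.\<close>
  define a where "a j = b j - (if j = 0 then s else 0)" for j
  define J where "J = insert 0 (snd ` S)"
  have J: "finite J" using S(1) by (simp add: J_def)
  have bF: "b j \<in> F" for j unfolding b_def
    by (intro is_subfield_sum[OF F(1)] is_subfieldD(5)[OF F(1)] is_subfield_power_int F(1,3))
      (use F(2) in blast)
  have "(\<Sum>j\<in>J. b j * v powi j) = (\<Sum>j\<in>J. \<Sum>q | q \<in> S \<and> snd q = j. \<iota> (w q) * u powi fst q * v powi snd q)"
    unfolding b_def sum_distrib_right by (intro sum.cong) auto
  also have "\<dots> = (\<Sum>q\<in>S. \<iota> (w q) * u powi fst q * v powi snd q)"
    by (rule sum.group[OF S(1) J]) (auto simp: J_def)
  also have "\<dots> = s" unfolding s_def step_eval_def by (intro sum.cong) auto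
  finally have "(\<Sum>j\<in>J. b j * v powi j) = s" .
  moreover have "(\<Sum>j\<in>J. (if j = 0 then s else 0) * v powi j) = (\<Sum>j\<in>J. if j = 0 then s else 0)"
    by (intro sum.cong) auto
  moreover have "\<dots> = s" using J by (simp add: J_def)
  ultimately have "(\<Sum>j\<in>J. a j * v powi j) = 0"
    by (simp add: a_def left_diff_distrib sum_subtractf)
  moreover have "a j \<in> F" for j
    using F(4) is_subfieldD(1)[OF F(1)] by (auto simp: a_def s_def intro!: is_subfield_diff[OF F(1)] bF)
  moreover have "a k \<noteq> 0"
  proof
    assume "a k = 0"
    define Q where "Q = {q. q \<in> S \<and> snd q = k}"
    \<comment> \<open>Steps with the same second component differ in the first, so their weights are
      not merged in the resulting relation for \<open>u\<close>.\<close>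
    have inj: "inj_on fst Q" by (auto simp: inj_on_def Q_def)
    have "(\<Sum>i\<in>fst ` Q. \<iota> (w (i, k)) * u powi i) = (\<Sum>q\<in>Q. \<iota> (w (fst q, k)) * u powi fst q)"
      by (simp add: sum.reindex[OF inj])
    also have "\<dots> = b k" unfolding b_def Q_def by (intro sum.cong) auto
    also have "\<dots> = 0" using \<open>a k = 0\<close> k(2) by (simp add: a_def)
    finally have "(\<Sum>i\<in>fst ` Q. \<iota> (w (i, k)) * u powi i) = 0" .
    moreover obtain i where "(i, k) \<in> S" using k(1) by force
    then have "i \<in> fst ` Q" "\<iota> (w (i, k)) \<noteq> 0"
      using S(2) field_embedding_props(7)[OF \<iota>] by (force simp: Q_def)+
    moreover have "finite (fst ` Q)" using S(1) by (simp add: Q_def)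
    ultimately have "algebraic_over (range \<iota>) u"
      using algebraic_over_laurent[OF R, of "fst ` Q" "\<lambda>i. \<iota> (w (i, k))" i u] u0 by blast
    then show False using u by blast
  qed
  moreover have "k \<in> J" using k by (simp add: J_def)
  ultimately show ?thesis using algebraic_over_laurent[OF F(1) J, of a k v] v by blast
qed

section \<open>Action of embeddings over the constants on the orbit\<close>

context
  fixes \<iota> :: "'c::field \<Rightarrow> 'k::field" and \<sigma> :: "'k \<Rightarrow> 'k"
  assumes \<sigma>: "field_embedding \<sigma>" and fix_\<iota>: "\<And>c. \<sigma> (\<iota> c) = \<iota> c"
begin

lemma field_embedding_step_eval: "\<sigma> (step_eval \<iota> S w u v) = step_eval \<iota> S w (\<sigma> u) (\<sigma> v)"
  unfolding step_eval_def
  by (simp add: field_embedding_sum[OF \<sigma>] field_embedding_props(3)[OF \<sigma>] fix_\<iota>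
      field_embedding_power_int[OF \<sigma>] case_prod_beta)

lemma field_embedding_step_defined: "step_defined S (\<sigma> u) (\<sigma> v) \<longleftrightarrow> step_defined S u v"
  unfolding step_defined_def by (simp add: field_embedding_props(7)[OF \<sigma>])

text \<open>\<sigma> fixes the weights, so it commutes with the step polynomial; definedness is
  preserved because only 0 is sent to 0.\<close>

lemma field_embedding_sim:
  "sim_x \<iota> S w p q \<Longrightarrow> sim_x \<iota> S w (map_prod \<sigma> \<sigma> p) (map_prod \<sigma> \<sigma> q)"
  "sim_y \<iota> S w p q \<Longrightarrow> sim_y \<iota> S w (map_prod \<sigma> \<sigma> p) (map_prod \<sigma> \<sigma> q)"
  unfolding sim_x_def sim_y_def same_step_value_def
  by (auto simp: field_embedding_step_defined simp flip: field_embedding_step_eval)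

text \<open>A path from \<open>(x, y)\<close> is carried to a path from its image, and the
  assumption joins that image to \<open>(x, y)\<close>.\<close>

lemma field_embedding_walk_orbit:
  assumes "(\<sigma> x, \<sigma> y) \<in> walk_orbit \<iota> S w x y"
  shows "map_prod \<sigma> \<sigma> ` walk_orbit \<iota> S w x y \<subseteq> walk_orbit \<iota> S w x y"
proof -
  let ?R = "sup (sim_x \<iota> S w) (sim_y \<iota> S w)"
  have "?R\<^sup>*\<^sup>* (x, y) (map_prod \<sigma> \<sigma> q)" if "?R\<^sup>*\<^sup>* (x, y) q" for q
    using that
  proof (induction rule: rtranclp_induct)
    case base
    show ?case using assms by (simp only: walk_orbit_def mem_Collect_eq map_prod_simp)
  next
    case (step q r)
    from step.hyps(2) have "?R (map_prod \<sigma> \<sigma> q) (map_prod \<sigma> \<sigma> r)"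
      by (rule sup2E) (blast intro: sup2I1 sup2I2 field_embedding_sim)+
    then show ?case using step.IH by (rule rtranclp.rtrancl_into_rtrancl[rotated])
  qed
  then show ?thesis unfolding walk_orbit_def by (auto simp only: mem_Collect_eq map_prod_simp)
qed

text \<open>The preimage of the orbit field under \<sigma> is a subfield containing all its
  generators.\<close>

lemma field_embedding_orbit_field:
  assumes "(\<sigma> x, \<sigma> y) \<in> walk_orbit \<iota> S w x y"
    and "\<And>a. a \<in> base_field \<iota> S w x y \<Longrightarrow> \<sigma> a = a"
  shows "\<sigma> ` orbit_field \<iota> S w x y \<subseteq> orbit_field \<iota> S w x y"
proof -
  let ?O = "walk_orbit \<iota> S w x y" and ?L = "orbit_field \<iota> S w x y"
  have sup: "base_field \<iota> S w x y \<subseteq> ?L" "fst ` ?O \<subseteq> ?L" "snd ` ?O \<subseteq> ?L"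
    using field_adjoin_superset(1)[of "base_field \<iota> S w x y" "fst ` ?O \<union> snd ` ?O"]
      field_adjoin_superset(2)[of "fst ` ?O \<union> snd ` ?O" "base_field \<iota> S w x y"]
    unfolding orbit_field_def by auto
  have "\<sigma> (fst q) \<in> ?L \<and> \<sigma> (snd q) \<in> ?L" if "q \<in> ?O" for q
  proof -
    have "map_prod \<sigma> \<sigma> q \<in> ?O" using field_embedding_walk_orbit[OF assms(1)] that by blast
    then show ?thesis using sup(2,3) by (metis fst_map_prod snd_map_prod image_subset_iff)
  qed
  then have "fst ` ?O \<union> snd ` ?O \<subseteq> \<sigma> -` ?L" by auto
  moreover have "base_field \<iota> S w x y \<subseteq> \<sigma> -` ?L" using sup(1) assms(2) by auto
  moreover have "is_subfield (\<sigma> -` ?L)"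
    using is_subfield_vimage[OF \<sigma>] is_subfield_field_adjoin unfolding orbit_field_def by blast
  ultimately have "?L \<subseteq> \<sigma> -` ?L"
    by (subst (1) orbit_field_def) (rule field_adjoin_least)
  then show ?thesis by blast
qed

end

theorem mainTheorem1:
  fixes \<iota> :: "complex \<Rightarrow> 'k::alg_closed_field"
    and x y :: 'k
    and S :: "(int \<times> int) set"
    and w :: "int \<times> int \<Rightarrow> complex"
  assumes "field_embedding \<iota>"
    and "algebraically_independent2 \<iota> x y"
    and "is_algebraic_closure_of TYPE('k) (field_adjoin (range \<iota>) {x, y})"
    and "finite S"
    and "\<And>s. s \<in> S \<Longrightarrow> w s \<noteq> 0"
    and "\<exists>(i, j)\<in>S. i \<noteq> 0"
    and "\<exists>(i, j)\<in>S. j \<noteq> 0"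
  shows "galois_extension (orbit_field \<iota> S w x y) (field_adjoin (base_field \<iota> S w x y) {x}) \<and>
         galois_extension (orbit_field \<iota> S w x y) (field_adjoin (base_field \<iota> S w x y) {y}) \<and>
         galois_extension (orbit_field \<iota> S w x y) (field_adjoin (base_field \<iota> S w x y) {x, y})"
proof -
  note \<iota> = assms(1)
  let ?s = "step_eval \<iota> S w x y" and ?k = "base_field \<iota> S w x y" and ?O = "walk_orbit \<iota> S w x y"
    and ?L = "orbit_field \<iota> S w x y"
  \<comment> \<open>Characteristic zero is inherited from the complex numbers through
    \<iota>.\<close>
  have char0: "of_nat (Suc n) \<noteq> (0::'k)" for n
    using field_embedding_of_nat[OF \<iota>, of "Suc n"] field_embedding_props(7)[OF \<iota>, of "of_nat (Suc n)"]
    by (metis of_nat_eq_0_iff old.nat.distinct(2))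
  have tr: "\<not> algebraic_over (range \<iota>) x" "\<not> algebraic_over (range \<iota>) y"
    using algebraically_independent2_transcendental[OF assms(1,2)] by auto
  then have nz: "x \<noteq> 0" "y \<noteq> 0" using algebraic_over_0[OF is_subfield_range[OF \<iota>]] by blast+
  have k: "range \<iota> \<subseteq> ?k" "?s \<in> ?k"
    unfolding base_field_def using field_adjoin_superset by blast+
  have xyO: "(x, y) \<in> ?O" by (simp add: walk_orbit_def)
  have kL: "?k \<subseteq> ?L" "x \<in> ?L" "y \<in> ?L"
    using field_adjoin_superset(1)[of ?k "fst ` ?O \<union> snd ` ?O"]
      field_adjoin_superset(2)[of "fst ` ?O \<union> snd ` ?O" ?k] imageI[OF xyO, of fst] imageI[OF xyO, of snd]
    by (auto simp: orbit_field_def)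
  have alg: "algebraic_over F z" if "is_subfield F" "?k \<subseteq> F" "x \<in> F \<or> y \<in> F" for F z
  proof -
    \<comment> \<open>With both coordinates present, \<open>G\<close> contains the rational function
      field in \<open>x\<close> and \<open>y\<close>, over which everything is algebraic.\<close>
    have *: "algebraic_over G z" if "is_subfield G" "?k \<subseteq> G" "x \<in> G" "y \<in> G" for G z
    proof -
      have "field_adjoin (range \<iota>) {x, y} \<subseteq> G"
        using that k by (intro field_adjoin_least) auto
      moreover have "algebraic_over (field_adjoin (range \<iota>) {x, y}) z"
        using assms(3) unfolding is_algebraic_closure_of_def by blast
      ultimately show ?thesis using algebraic_over_mono by blast
    qed
    \<comment> \<open>With one coordinate, the other one, \<open>t\<close>, is adjoined first, and
      algebraicity passes down the tower.\<close>
    have **: "algebraic_over F z" if "algebraic_over F t" "x \<in> F \<and> t = y \<or> y \<in> F \<and> t = x" for t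
    proof (rule algebraic_over_trans[OF \<open>is_subfield F\<close> that(1)])
      show "algebraic_over (field_adjoin F {t}) z"
        using that(2) \<open>?k \<subseteq> F\<close> field_adjoin_superset(1)[of F "{t}"] field_adjoin_superset(2)[of "{t}" F]
        by (intro * is_subfield_field_adjoin) auto
    qed
    show ?thesis
    proof (cases "x \<in> F")
      case True
      have "algebraic_over F y"
        using True that k by (intro algebraic_over_second_coordinate[OF \<iota> tr(1) nz(2) assms(4,5,7)]) auto
      then show ?thesis using ** True by blast
    next
      case False
      then have y: "y \<in> F" using that by blast
      have "\<exists>(i, j)\<in>prod.swap ` S. j \<noteq> 0" using assms(6) by force
      moreover have "(w \<circ> prod.swap) q \<noteq> 0" if "q \<in> prod.swap ` S" for q using that assms(5) by auto
      moreover have "step_eval \<iota> (prod.swap ` S) (w \<circ> prod.swap) y x \<in> F"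
        using k that(2) by (auto simp: step_eval_swap)
      moreover have "range \<iota> \<subseteq> F" using k that(2) by blast
      ultimately have "algebraic_over F x"
        using that(1) y assms(4)
        by (intro algebraic_over_second_coordinate[OF \<iota> tr(2) nz(1), of "prod.swap ` S" "w \<circ> prod.swap"])
          simp_all
      then show ?thesis using ** y by blast
    qed
  qed
  have galois: "galois_extension ?L (field_adjoin ?k A)" if A: "A \<subseteq> {x, y}" "A \<noteq> {}" for A
  proof (rule galois_extension_if_stable)
    let ?M = "field_adjoin ?k A"
    show "is_subfield ?L" unfolding orbit_field_def by (rule is_subfield_field_adjoin)
    then show "?M \<subseteq> ?L" using A kL by (intro field_adjoin_least) auto
    show "is_subfield ?M" by (rule is_subfield_field_adjoin)
    have M: "?k \<subseteq> ?M" "A \<subseteq> ?M" by (rule field_adjoin_superset)+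
    then show "algebraic_over ?M z" for z
      using A by (intro alg is_subfield_field_adjoin) auto
    show "of_nat (Suc n) \<noteq> (0::'k)" for n by (rule char0)
    fix \<sigma> :: "'k \<Rightarrow> 'k"
    assume \<sigma>: "field_embedding \<sigma>" and fixed: "\<And>a. a \<in> ?M \<Longrightarrow> \<sigma> a = a"
    have fix_\<iota>: "\<sigma> (\<iota> c) = \<iota> c" for c using fixed M k by blast
    have "step_eval \<iota> S w (\<sigma> x) (\<sigma> y) = ?s"
      using field_embedding_step_eval[OF \<sigma> fix_\<iota>, where S = S and w = w and u = x and v = y] fixed[of ?s] M k by auto
    \<comment> \<open>All four coordinates are nonzero, so negative powers are meaningful at both
      points.\<close>
    then have same: "same_step_value \<iota> S w (x, y) (\<sigma> x, \<sigma> y)"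
      using nz field_embedding_props(7)[OF \<sigma>]
      by (auto simp: same_step_value_def step_defined_def)
    \<comment> \<open>As \<open>A\<close> is nonempty, at least one coordinate is fixed, which makes
      the two points adjacent in all three cases.\<close>
    have "\<sigma> x = x \<or> \<sigma> y = y" using A M fixed by blast
    then have "sup (sim_x \<iota> S w) (sim_y \<iota> S w) (x, y) (\<sigma> x, \<sigma> y)"
      using same by (auto simp: sim_x_def sim_y_def)
    then have "(\<sigma> x, \<sigma> y) \<in> ?O" unfolding walk_orbit_def by (simp only: mem_Collect_eq r_into_rtranclp)
    then show "\<sigma> ` ?L \<subseteq> ?L"
      by (intro field_embedding_orbit_field \<sigma> fix_\<iota> fixed) (use M in auto)
  qed
  show ?thesis using galois[of "{x}"] galois[of "{y}"] galois[of "{x, y}"] by simp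
qed

end
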